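(* Let $l>0$, $p>1$ and, for $\alpha>0$ and $x\in[-1,1]$, let \[ \lambda(\alpha)=(\alpha+1)^{1-p}\left[\eta\left(\tfrac{\alpha}{\alpha+1}\right)\right]^{l+2},\qquad U(x;\alpha)=(\alpha+1)\,w\left(\eta\left(\tfrac{\alpha}{\alpha+1}\right)|x|\right)+\alpha, \] with $w,\eta$ as in the context. Then $\lambda(\alpha)\in C^2(0,\infty)$, $U(x;\alpha)\in C^2([-1,1]\times(0,\infty))$, and \[ \lim_{\alpha\to+0}\lambda(\alpha)=\lim_{\alpha\to\infty}\lambda(\alpha)=0. \] Moreover, there exists $\alpha_*>0$ such that $\lambda'(\alpha)>0$ for $0<\alpha<\alpha_*$, $\lambda'(\alpha_* )=0$, and $\lambda'(\alpha)<0$ for $\alpha>\alpha_*$.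
   Context: $w$ is the unique solution of $w''+|x|^l(w+1)^p=0$ for $x>0$, $w(0)=w'(0)=0$. There is $x_1>0$ such that $-1<w<0$, $w'<0$, $w''<0$ on $(0,x_1)$, $w(x_1)=-1$ and $w'(x_1)<0$; $\eta:[0,1]\to[0,x_1]$ denotes the inverse function of $-w|_{[0,x_1]}$. *)

theory Defs
  imports "HOL-Analysis.Analysis"
begin

text \<open>
  Class C^2 on a set, via the first and second Frechet derivatives relative to the set
  (one-sided at boundary points). It is used for \<open>{0<..}\<close> and
  \<open>{-1..1} \<times> {0<..}\<close>, where derivatives relative to the set are unique. Continuity of
  \<open>f\<close> and \<open>f'\<close> follows from differentiability.
\<close>

definition C2_on :: "'a::real_normed_vector set \<Rightarrow> ('a \<Rightarrow> 'b::real_normed_vector) \<Rightarrow> bool" where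
  "C2_on S f \<longleftrightarrow>
     (\<exists>(f' :: 'a \<Rightarrow> 'a \<Rightarrow>\<^sub>L 'b) (f'' :: 'a \<Rightarrow> 'a \<Rightarrow>\<^sub>L ('a \<Rightarrow>\<^sub>L 'b)).
        (\<forall>x\<in>S. (f has_derivative blinfun_apply (f' x)) (at x within S)) \<and>
        (\<forall>x\<in>S. (f' has_derivative blinfun_apply (f'' x)) (at x within S)) \<and>
        continuous_on S f'')"

text \<open>
  \<open>w\<close>, with first and second derivatives \<open>w'\<close> and \<open>w''\<close>, solves
  \<open>w'' + |x|^l (w + 1)^p = 0\<close>, \<open>w(0) = w'(0) = 0\<close> on \<open>[0, T]\<close>. The derivatives are
  one-sided at the end points; the equation is imposed for \<open>0 < x \<le> T\<close>, and \<open>w\<close> is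
  \<open>C^1\<close> up to \<open>0\<close>.
\<close>

definition solves_ivp ::
  "real \<Rightarrow> real \<Rightarrow> real \<Rightarrow> (real \<Rightarrow> real) \<Rightarrow> (real \<Rightarrow> real) \<Rightarrow> (real \<Rightarrow> real) \<Rightarrow> bool" where
  "solves_ivp l p T w w' w'' \<longleftrightarrow>
     w 0 = 0 \<and> w' 0 = 0 \<and>
     (\<forall>x\<in>{0..T}. (w has_real_derivative w' x) (at x within {0..T})) \<and>
     continuous_on {0..T} w' \<and>
     (\<forall>x\<in>{0<..T}. (w' has_real_derivative w'' x) (at x within {0..T})) \<and>
     (\<forall>x\<in>{0<..T}. w'' x + \<bar>x\<bar> powr l * (w x + 1) powr p = 0)"

definition eta :: "(real \<Rightarrow> real) \<Rightarrow> real \<Rightarrow> real \<Rightarrow> real" where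
  "eta w x1 = the_inv_into {0..x1} (\<lambda>x. - w x)"

definition lam :: "real \<Rightarrow> real \<Rightarrow> (real \<Rightarrow> real) \<Rightarrow> real \<Rightarrow> real \<Rightarrow> real" where
  "lam l p w x1 \<alpha> = (\<alpha> + 1) powr (1 - p) * eta w x1 (\<alpha> / (\<alpha> + 1)) powr (l + 2)"

definition U :: "(real \<Rightarrow> real) \<Rightarrow> real \<Rightarrow> real \<Rightarrow> real \<Rightarrow> real" where
  "U w x1 x \<alpha> = (\<alpha> + 1) * w (eta w x1 (\<alpha> / (\<alpha> + 1)) * \<bar>x\<bar>) + \<alpha>"

end

theory Submission
  imports Defs "HOL-Real_Asymp.Real_Asymp"
begin

text \<open>
  With \<open>y = \<eta> (\<alpha> / (\<alpha> + 1))\<close> one has \<open>1 / (\<alpha> + 1) = w y + 1\<close>, so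
  \<open>\<lambda> = (w y + 1) powr (p - 1) * y powr (l + 2)\<close>, where \<open>y\<close> runs increasingly through \<open>(0, x1)\<close>.
  This gives the limits, and up to a positive factor the derivative of \<open>\<lambda>\<close> is
  \<open>h y = (p - 1) * y * w' y + (l + 2) * (w y + 1)\<close>, which decreases strictly from a positive
  to a negative value because \<open>w' < 0\<close> and \<open>w'' < 0\<close>. For the smoothness of \<open>U\<close> at \<open>x = 0\<close>, the
  even extension of \<open>w\<close> is of class \<open>C\<^sup>2\<close> since \<open>w' 0 = 0\<close>.
\<close>

section \<open>Criteria for twice continuous differentiability\<close>

text \<open>A linear map of the reals is a multiple of the identity. Ordinary derivatives thus
  become Frechet derivatives through \<open>B\<close>, which embeds the numbers as multiples of
  \<open>id_blinfun\<close>.\<close>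

lemma C2_on_realI:
  fixes f f1 f2 :: "real \<Rightarrow> real"
  assumes f: "\<And>x. x \<in> S \<Longrightarrow> (f has_real_derivative f1 x) (at x within S)"
    and f1: "\<And>x. x \<in> S \<Longrightarrow> (f1 has_real_derivative f2 x) (at x within S)"
    and f2: "continuous_on S f2"
  shows "C2_on S f"
proof -
  define B :: "real \<Rightarrow>\<^sub>L (real \<Rightarrow>\<^sub>L real)" where "B = Blinfun (\<lambda>h. h *\<^sub>R id_blinfun)"
  have B: "blinfun_apply B = (\<lambda>h. h *\<^sub>R id_blinfun)"
    unfolding B_def by (intro bounded_linear_Blinfun_apply bounded_linear_scaleR_left)
  show ?thesis
    unfolding C2_on_def
  proof (intro exI conjI ballI)
    fix x assume x: "x \<in> S"
    show "(f has_derivative blinfun_apply (f1 x *\<^sub>R id_blinfun)) (at x within S)"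
      using f[OF x] by (simp add: has_field_derivative_def scaleR_blinfun.rep_eq)
    show "((\<lambda>x. f1 x *\<^sub>R id_blinfun) has_derivative blinfun_apply (f2 x *\<^sub>R B)) (at x within S)"
      using has_derivative_scaleR_left[OF f1[OF x, unfolded has_field_derivative_def], of id_blinfun]
      by (simp add: scaleR_blinfun.rep_eq B)
  qed (intro continuous_intros f2)
qed

lemma C2_on_prodI:
  fixes f f1 f2 f11 f12 f21 f22 :: "real \<times> real \<Rightarrow> real"
  assumes f: "\<And>z. z \<in> S \<Longrightarrow> (f has_derivative (\<lambda>h. fst h * f1 z + snd h * f2 z)) (at z within S)"
    and f1: "\<And>z. z \<in> S \<Longrightarrow> (f1 has_derivative (\<lambda>h. fst h * f11 z + snd h * f12 z)) (at z within S)"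
    and f2: "\<And>z. z \<in> S \<Longrightarrow> (f2 has_derivative (\<lambda>h. fst h * f21 z + snd h * f22 z)) (at z within S)"
    and cont: "continuous_on S f11" "continuous_on S f12" "continuous_on S f21" "continuous_on S f22"
  shows "C2_on S f"
proof -
  let ?F = "fst_blinfun :: (real \<times> real) \<Rightarrow>\<^sub>L real" and ?S = "snd_blinfun :: (real \<times> real) \<Rightarrow>\<^sub>L real"
  \<comment> \<open>\<open>B L M\<close> is the bilinear form taking the directions h, k to L h * M
    k. The four products of the two projections carry the four second partial derivatives as
    coefficients.\<close>
  define B where "B = (\<lambda>(L :: (real \<times> real) \<Rightarrow>\<^sub>L real) (M :: (real \<times> real) \<Rightarrow>\<^sub>L real).
    Blinfun (\<lambda>h. blinfun_apply L h *\<^sub>R M))"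
  have B: "blinfun_apply (B L M) = (\<lambda>h. blinfun_apply L h *\<^sub>R M)" for L M
    unfolding B_def by (intro bounded_linear_Blinfun_apply bounded_linear_intros)
  show ?thesis
    unfolding C2_on_def
  proof (intro exI conjI ballI)
    fix z assume z: "z \<in> S"
    show "(f has_derivative blinfun_apply (f1 z *\<^sub>R ?F + f2 z *\<^sub>R ?S)) (at z within S)"
      using f[OF z] by (simp add: plus_blinfun.rep_eq scaleR_blinfun.rep_eq mult.commute)
    show "((\<lambda>z. f1 z *\<^sub>R ?F + f2 z *\<^sub>R ?S) has_derivative
       blinfun_apply (f11 z *\<^sub>R B ?F ?F + f12 z *\<^sub>R B ?S ?F + f21 z *\<^sub>R B ?F ?S + f22 z *\<^sub>R B ?S ?S))
       (at z within S)"
      by (rule has_derivative_eq_rhs[OF has_derivative_add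
            [OF has_derivative_scaleR_left[OF f1[OF z]] has_derivative_scaleR_left[OF f2[OF z]]]])
        (simp add: plus_blinfun.rep_eq scaleR_blinfun.rep_eq B algebra_simps)
  qed (intro continuous_intros cont)
qed

section \<open>Even and odd extensions\<close>

text \<open>\<open>abs\<close> maps a punctured neighbourhood of 0 into the interval without 0, so a
  one-sided limit at 0 becomes two-sided. It serves below for difference quotients at 0.\<close>

lemma tendsto_compose_abs:
  fixes g :: "real \<Rightarrow> real"
  assumes "(g \<longlongrightarrow> L) (at 0 within {0..T})" "T > 0"
  shows "((\<lambda>t. g \<bar>t\<bar>) \<longlongrightarrow> L) (at 0)"
proof (rule filterlim_compose[OF assms(1)])
  have "eventually (\<lambda>t::real. \<bar>t\<bar> \<in> {0..T} - {0}) (at 0)"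
    unfolding eventually_at using assms(2) by (intro exI[of _ T]) auto
  moreover have "(abs \<longlongrightarrow> (0::real)) (at 0)"
    by (rule tendsto_eq_intros refl)+ simp
  ultimately show "filterlim abs (at (0::real) within {0..T}) (at 0)"
    unfolding filterlim_at by (auto elim: eventually_mono)
qed

text \<open>Away from 0 this is the chain rule. At 0 the quotient of the even extension agrees up to
  sign with the one-sided quotient of \<open>f\<close>, and the sign is harmless because the limit
  \<open>f' 0\<close> is 0.\<close>

lemma DERIV_even_extension:
  fixes f f' :: "real \<Rightarrow> real"
  assumes D: "\<And>x. x \<in> {0..T} \<Longrightarrow> (f has_real_derivative f' x) (at x within {0..T})"
    and "f' 0 = 0" and t: "\<bar>t\<bar> < T"
  shows "((\<lambda>t. f \<bar>t\<bar>) has_real_derivative sgn t * f' \<bar>t\<bar>) (at t)"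
proof -
  have D': "(f has_real_derivative f' x) (at x)" if "0 < x" "x < T" for x
    using D[of x] that by (simp add: at_within_Icc_at)
  consider "t > 0" | "t < 0" | "t = 0" by linarith
  then show ?thesis
  proof cases
    case 1
    then have "(f has_real_derivative sgn t * f' \<bar>t\<bar>) (at t)"
      using D'[of t] t by simp
    then show ?thesis
      by (rule has_field_derivative_transform_within_open[where S = "{0<..}"]) (use 1 in auto)
  next
    case 2
    then have "((\<lambda>t. f (- t)) has_real_derivative sgn t * f' \<bar>t\<bar>) (at t)"
      using D'[of "- t"] t DERIV_mirror[of f "f' (- t)" t] by simp
    then show ?thesis
      by (rule has_field_derivative_transform_within_open[where S = "{..<0}"]) (use 2 in auto)
  next
    case 3
    have "((\<lambda>y. (f \<bar>y\<bar> - f 0) / \<bar>y\<bar>) \<longlongrightarrow> 0) (at 0)"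
      using D[of 0] t 3 \<open>f' 0 = 0\<close>
      by (intro tendsto_compose_abs[where T = T and g = "\<lambda>y. (f y - f 0) / y"])
        (auto simp: has_field_derivative_iff)
    \<comment> \<open>Dividing by y instead of |y| leaves the absolute value unchanged, which
      suffices for a limit equal to 0.\<close>
    then have "((\<lambda>y. (f \<bar>y\<bar> - f 0) / y) \<longlongrightarrow> 0) (at 0)"
      by (rule Lim_transform_bound[rotated]) simp
    then show ?thesis
      by (simp add: 3 has_field_derivative_iff)
  qed
qed

text \<open>The difference quotient at 0 of an odd function is even, so here the one-sided limit
  \<open>f' 0\<close> carries over whatever its value.\<close>

lemma DERIV_odd_extension:
  fixes f f' :: "real \<Rightarrow> real"
  assumes D: "\<And>x. x \<in> {0..T} \<Longrightarrow> (f has_real_derivative f' x) (at x within {0..T})"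
    and "f 0 = 0" and t: "\<bar>t\<bar> < T"
  shows "((\<lambda>t. sgn t * f \<bar>t\<bar>) has_real_derivative f' \<bar>t\<bar>) (at t)"
proof -
  have D': "(f has_real_derivative f' x) (at x)" if "0 < x" "x < T" for x
    using D[of x] that by (simp add: at_within_Icc_at)
  consider "t > 0" | "t < 0" | "t = 0" by linarith
  then show ?thesis
  proof cases
    case 1
    then have "(f has_real_derivative f' \<bar>t\<bar>) (at t)"
      using D'[of t] t by simp
    then show ?thesis
      by (rule has_field_derivative_transform_within_open[where S = "{0<..}"]) (use 1 in auto)
  next
    case 2
    then have "((\<lambda>t. - f (- t)) has_real_derivative f' \<bar>t\<bar>) (at t)"
      using D'[of "- t"] t DERIV_minus[OF DERIV_mirror[THEN iffD1, of f "f' (- t)" t]] by simp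
    then show ?thesis
      by (rule has_field_derivative_transform_within_open[where S = "{..<0}"]) (use 2 in auto)
  next
    case 3
    have "((\<lambda>y. f \<bar>y\<bar> / \<bar>y\<bar>) \<longlongrightarrow> f' 0) (at 0)"
      using D[of 0] t 3 \<open>f 0 = 0\<close>
      by (intro tendsto_compose_abs[where T = T and g = "\<lambda>y. f y / y"])
        (auto simp: has_field_derivative_iff)
    moreover have "sgn y * f \<bar>y\<bar> / y = f \<bar>y\<bar> / \<bar>y\<bar>" for y :: real
      by (simp add: sgn_if)
    ultimately show ?thesis
      by (simp add: 3 has_field_derivative_iff)
  qed
qed

section \<open>The solution and its inverse function\<close>

text \<open>The second derivative is eliminated through the equation. Its sign is recovered from
  \<open>w x > -1\<close> in \<open>w2_neg\<close>, and the sign of \<open>w\<close> from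
  monotonicity.\<close>

locale lane_emden_solution =
  fixes l p x1 :: real and w w' :: "real \<Rightarrow> real"
  assumes l: "l > 0" and p: "p > 1" and x1: "x1 > 0"
    and w_0: "w 0 = 0" and w'_0: "w' 0 = 0"
    and DERIV_w: "\<And>x. x \<in> {0..x1} \<Longrightarrow> (w has_real_derivative w' x) (at x within {0..x1})"
    and cont_w': "continuous_on {0..x1} w'"
    and DERIV_w'_pos: "\<And>x. x \<in> {0<..x1} \<Longrightarrow>
      (w' has_real_derivative - (x powr l * (w x + 1) powr p)) (at x within {0..x1})"
    and w_gt: "\<And>x. x \<in> {0<..<x1} \<Longrightarrow> w x > -1"
    and w_x1: "w x1 = -1"
    and w'_neg: "\<And>x. x \<in> {0<..x1} \<Longrightarrow> w' x < 0"
begin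

text \<open>
  The equation determines \<open>w''\<close> only for positive arguments; \<open>w2\<close> is its continuous extension to \<open>0\<close>.
\<close>

definition w2 :: "real \<Rightarrow> real"
  where "w2 x = - (x powr l * (w x + 1) powr p)"

lemma w2_neg: "x \<in> {0<..<x1} \<Longrightarrow> w2 x < 0"
  using w_gt[of x] by (simp add: w2_def)

lemma cont_w: "continuous_on {0..x1} w"
  using DERIV_w by (meson DERIV_continuous_on)

lemma w_ge: "x \<in> {0..x1} \<Longrightarrow> w x \<ge> -1"
  using w_gt[of x] w_0 w_x1 by (cases "x = 0 \<or> x = x1") auto

text \<open>Each base vanishes at an end point, x at 0 and w x + 1 at \<open>x1\<close>. Continuity
  of the powers there rests on non-negative bases and positive exponents.\<close>

lemma cont_w2: "continuous_on {0..x1} w2"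
  unfolding w2_def using l p w_ge
  by (intro continuous_intros continuous_on_powr' cont_w) force+

lemma DERIV_w'_at: "x \<in> {0<..<x1} \<Longrightarrow> (w' has_real_derivative w2 x) (at x)"
  using DERIV_w'_pos[of x] by (simp add: w2_def at_within_Icc_at)

lemma DERIV_w_at: "x \<in> {0<..<x1} \<Longrightarrow> (w has_real_derivative w' x) (at x)"
  using DERIV_w[of x] by (simp add: at_within_Icc_at)

text \<open>By the mean value theorem w' x / x equals \<open>w2 z\<close> for some z between 0 and
  x, and \<open>w2\<close> is continuous with \<open>w2 0 = 0\<close>. Hence \<open>w\<close> is
  twice differentiable up to 0.\<close>

lemma DERIV_w'_0: "(w' has_real_derivative 0) (at 0 within {0..x1})"
proof -
  have "((\<lambda>x. w' x / x) \<longlongrightarrow> 0) (at 0 within {0..x1})"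
  proof (rule tendstoI)
    fix e :: real assume "e > 0"
    have "(w2 \<longlongrightarrow> w2 0) (at 0 within {0..x1})"
      using cont_w2 x1 unfolding continuous_on_def by force
    then obtain d where d: "d > 0"
      "\<And>x. x \<in> {0..x1} \<Longrightarrow> x \<noteq> 0 \<Longrightarrow> dist x 0 < d \<Longrightarrow> dist (w2 x) 0 < e"
      using \<open>e > 0\<close> l by (auto simp: tendsto_iff eventually_at w2_def)
    have "dist (w' x / x) 0 < e" if x: "x \<in> {0..x1}" "x \<noteq> 0" "dist x 0 < d" for x
    proof -
      have "\<exists>L z. 0 < z \<and> z < x \<and> (w' has_real_derivative L) (at z) \<and> w' x - w' 0 = (x - 0) * L"
      proof (rule MVT)
        show "continuous_on {0..x} w'"
          using x by (intro continuous_on_subset[OF cont_w']) auto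
        show "w' differentiable at z" if "0 < z" "z < x" for z
          using DERIV_w'_at[of z] that x unfolding real_differentiable_def by auto
      qed (use x in auto)
      then obtain L z where z: "0 < z" "z < x" "(w' has_real_derivative L) (at z)" "w' x = x * L"
        by (auto simp: w'_0)
      then have "L = w2 z"
        using x DERIV_w'_at[of z] by (intro DERIV_unique[of w' _ z]) auto
      then show ?thesis
        using z x d(2)[of z] by (simp add: dist_real_def)
    qed
    then show "\<forall>\<^sub>F x in at 0 within {0..x1}. dist (w' x / x) 0 < e"
      unfolding eventually_at using d(1) by blast
  qed
  then show ?thesis
    by (simp add: has_field_derivative_iff w'_0)
qed

lemma DERIV_w': "x \<in> {0..x1} \<Longrightarrow> (w' has_real_derivative w2 x) (at x within {0..x1})"
  using DERIV_w'_0 DERIV_w'_pos[of x] l by (cases "x = 0") (auto simp: w2_def)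

section \<open>Monotonicity of \<open>w\<close> and its inverse function\<close>

lemma w_less: "w b < w a" if "0 \<le> a" "a < b" "b \<le> x1"
proof (rule DERIV_neg_imp_decreasing_open[OF \<open>a < b\<close>])
  show "\<exists>y. DERIV w x :> y \<and> y < 0" if "a < x" "x < b" for x
    using that \<open>0 \<le> a\<close> \<open>b \<le> x1\<close> DERIV_w_at[of x] w'_neg[of x] by auto
  show "continuous_on {a..b} w"
    using that by (intro continuous_on_subset[OF cont_w]) auto
qed

lemma w_eq_iff: "x \<in> {0..x1} \<Longrightarrow> z \<in> {0..x1} \<Longrightarrow> w x = w z \<longleftrightarrow> x = z"
  using w_less[of x z] w_less[of z x] by (cases x z rule: linorder_cases) auto

lemma image_w: "(\<lambda>x. - w x) ` {0..x1} = {0..1}"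
proof
  have "w x \<le> 0" if "x \<in> {0..x1}" for x
    using w_less[of 0 x] w_0 that by (cases "x = 0") auto
  then show "(\<lambda>x. - w x) ` {0..x1} \<subseteq> {0..1}"
    using w_ge by force
  have "\<exists>x. 0 \<le> x \<and> x \<le> x1 \<and> - w x = s" if "s \<in> {0..1}" for s
    using that w_0 w_x1 x1 by (intro IVT') (auto intro!: continuous_intros cont_w)
  then show "{0..1} \<subseteq> (\<lambda>x. - w x) ` {0..x1}"
    by force
qed

abbreviation "\<eta> \<equiv> eta w x1"

lemma eta_w: "x \<in> {0..x1} \<Longrightarrow> \<eta> (- w x) = x"
  unfolding eta_def by (rule the_inv_into_f_f) (auto intro!: inj_onI simp: w_eq_iff)

lemma eta: assumes "s \<in> {0..1}" shows "\<eta> s \<in> {0..x1}" "w (\<eta> s) = - s"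
  using assms eta_w unfolding image_w[symmetric] by auto

lemma eta_0: "\<eta> 0 = 0" and eta_1: "\<eta> 1 = x1"
  using eta_w[of 0] eta_w[of x1] x1 w_0 w_x1 by auto

lemma eta_interior: assumes "s \<in> {0<..<1}" shows "\<eta> s \<in> {0<..<x1}"
proof -
  have "\<eta> s \<noteq> 0" "\<eta> s \<noteq> x1"
    using eta(2)[of s] assms w_0 w_x1 by auto
  then show ?thesis
    using eta(1)[of s] assms by auto
qed

text \<open>A continuous injection on a compact set has a continuous inverse. The end points are
  included since the limits of \<open>lam\<close> use them.\<close>

lemma cont_eta: "continuous_on {0..1} \<eta>"
  unfolding image_w[symmetric]
  by (intro continuous_on_inv continuous_intros cont_w) (auto simp: eta_w)

text \<open>The point s = 0 must be left out because \<open>w'\<close> vanishes at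
  \<open>\<eta> 0 = 0\<close>. For \<alpha> > 0 the argument \<alpha> / (\<alpha> + 1) stays inside
  the open interval.\<close>

lemma DERIV_eta: assumes "s \<in> {0<..<1}" shows "(\<eta> has_real_derivative - 1 / w' (\<eta> s)) (at s)"
proof -
  have "(\<eta> has_real_derivative inverse (- w' (\<eta> s))) (at s)"
  proof (rule DERIV_inverse_function[where a = 0 and b = 1 and f = "\<lambda>x. - w x"])
    show "((\<lambda>x. - w x) has_real_derivative - w' (\<eta> s)) (at (\<eta> s))"
      by (intro DERIV_minus DERIV_w_at eta_interior assms)
    show "- w' (\<eta> s) \<noteq> 0"
      using w'_neg[of "\<eta> s"] eta_interior[OF assms] by auto
    show "isCont \<eta> s"
      using cont_eta assms by (intro continuous_on_interior) auto
  qed (use assms eta in auto)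
  then show ?thesis by (simp add: field_simps)
qed

section \<open>The substitution by \<open>y\<close> and its derivatives\<close>

definition y :: "real \<Rightarrow> real"
  where "y \<alpha> = \<eta> (\<alpha> / (\<alpha> + 1))"

text \<open>The derivative of \<open>y\<close>, as obtained by differentiating w (y \<alpha>) = 1 /
  (\<alpha> + 1) - 1; the quotient rule then yields \<open>y2\<close>.\<close>

definition y1 :: "real \<Rightarrow> real"
  where "y1 \<alpha> = - 1 / (w' (y \<alpha>) * (\<alpha> + 1)\<^sup>2)"

definition y2 :: "real \<Rightarrow> real"
  where "y2 \<alpha> = (w2 (y \<alpha>) * y1 \<alpha> * (\<alpha> + 1)\<^sup>2 + w' (y \<alpha>) * (2 * (\<alpha> + 1))) / (w' (y \<alpha>) * (\<alpha> + 1)\<^sup>2)\<^sup>2"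

lemma y_interior: "\<alpha> > 0 \<Longrightarrow> y \<alpha> \<in> {0<..<x1}"
  unfolding y_def by (rule eta_interior) auto

lemma w_y: "\<alpha> > 0 \<Longrightarrow> w (y \<alpha>) = - (\<alpha> / (\<alpha> + 1))"
  unfolding y_def by (rule eta) auto

lemma w'_y_neg: "\<alpha> > 0 \<Longrightarrow> w' (y \<alpha>) < 0"
  using w'_neg[of "y \<alpha>"] y_interior[of \<alpha>] by auto

lemma y_less: assumes "0 < a" "a < b" shows "y a < y b"
proof (rule ccontr)
  assume "\<not> y a < y b"
  then have "w (y a) \<le> w (y b)"
    using w_less[of "y b" "y a"] y_interior[of a] y_interior[of b] assms by (cases "y a = y b") auto
  then show False
    using assms by (simp add: w_y field_simps)
qed

lemma DERIV_y: assumes "\<alpha> > 0" shows "(y has_real_derivative y1 \<alpha>) (at \<alpha>)"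
proof -
  have "((\<lambda>\<alpha>. \<alpha> / (\<alpha> + 1)) has_real_derivative 1 / (\<alpha> + 1)\<^sup>2) (at \<alpha>)"
    using assms by (auto intro!: derivative_eq_intros simp: field_simps power2_eq_square)
  from DERIV_chain2[OF DERIV_eta this] show ?thesis
    using assms unfolding y_def[abs_def] y1_def by simp
qed

lemma DERIV_y1: assumes "\<alpha> > 0" shows "(y1 has_real_derivative y2 \<alpha>) (at \<alpha>)"
proof -
  have d: "((\<lambda>\<alpha>. w' (y \<alpha>) * (\<alpha> + 1)\<^sup>2) has_real_derivative
      w2 (y \<alpha>) * y1 \<alpha> * (\<alpha> + 1)\<^sup>2 + w' (y \<alpha>) * (2 * (\<alpha> + 1))) (at \<alpha>)"
    using DERIV_chain2[OF DERIV_w'_at[OF y_interior[OF assms]] DERIV_y[OF assms]]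
    by (auto intro!: derivative_eq_intros)
  show ?thesis
    unfolding y1_def[abs_def] y2_def
    by (rule DERIV_cong[OF DERIV_divide[OF DERIV_const d]])
      (use w'_y_neg[OF assms] assms in \<open>auto simp: y1_def power2_eq_square\<close>)
qed

lemma cont_y: "continuous_on {0<..} y"
  using DERIV_y by (intro continuous_at_imp_continuous_on) (auto intro: DERIV_isCont)

lemma cont_y1: "continuous_on {0<..} y1"
  using DERIV_y1 by (intro continuous_at_imp_continuous_on) (auto intro: DERIV_isCont)

lemma cont_y2: "continuous_on {0<..} y2"
proof -
  have "y ` {0<..} \<subseteq> {0..x1}"
    using y_interior by force
  then show ?thesis
    unfolding y2_def[abs_def] using w'_y_neg
    by (intro continuous_intros cont_y cont_y1 continuous_on_compose2[OF cont_w2]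
        continuous_on_compose2[OF cont_w']) (auto dest: less_imp_neq)
qed

section \<open>The bifurcation parameter\<close>

definition lam1 :: "real \<Rightarrow> real"
  where "lam1 \<alpha> = (1 - p) * (\<alpha> + 1) powr (- p) * y \<alpha> powr (l + 2)
    + (\<alpha> + 1) powr (1 - p) * ((l + 2) * y \<alpha> powr (l + 1) * y1 \<alpha>)"

definition lam2 :: "real \<Rightarrow> real"
  where "lam2 \<alpha> = (1 - p) * (- p) * (\<alpha> + 1) powr (- p - 1) * y \<alpha> powr (l + 2)
    + 2 * (1 - p) * (\<alpha> + 1) powr (- p) * ((l + 2) * y \<alpha> powr (l + 1) * y1 \<alpha>)
    + (\<alpha> + 1) powr (1 - p) * ((l + 2) * ((l + 1) * y \<alpha> powr l * (y1 \<alpha>)\<^sup>2 + y \<alpha> powr (l + 1) * y2 \<alpha>))"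

lemma lam_eq: "lam l p w x1 = (\<lambda>\<alpha>. (\<alpha> + 1) powr (1 - p) * y \<alpha> powr (l + 2))"
  by (simp add: lam_def y_def fun_eq_iff)

lemma DERIV_y_powr: "\<alpha> > 0 \<Longrightarrow>
    ((\<lambda>\<alpha>. y \<alpha> powr r) has_real_derivative r * y \<alpha> powr (r - 1) * y1 \<alpha>) (at \<alpha>)"
  using DERIV_fun_powr[OF DERIV_y, of \<alpha> r] y_interior[of \<alpha>] by simp

lemma DERIV_shift_powr: "\<alpha> > 0 \<Longrightarrow>
    ((\<lambda>\<alpha>::real. (\<alpha> + 1) powr r) has_real_derivative r * (\<alpha> + 1) powr (r - 1)) (at \<alpha>)"
  by (auto intro!: derivative_eq_intros)

lemma DERIV_lam: assumes "\<alpha> > 0" shows "(lam l p w x1 has_real_derivative lam1 \<alpha>) (at \<alpha>)"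
  unfolding lam_eq
  by (rule DERIV_cong[OF DERIV_mult[OF DERIV_shift_powr[OF assms] DERIV_y_powr[OF assms]]])
    (simp add: lam1_def algebra_simps)

lemma DERIV_lam1: assumes "\<alpha> > 0" shows "(lam1 has_real_derivative lam2 \<alpha>) (at \<alpha>)"
  unfolding lam1_def[abs_def]
  by (rule DERIV_cong[OF DERIV_add
        [OF DERIV_mult[OF DERIV_cmult[OF DERIV_shift_powr[OF assms]] DERIV_y_powr[OF assms]]
            DERIV_mult[OF DERIV_shift_powr[OF assms]
              DERIV_mult[OF DERIV_cmult[OF DERIV_y_powr[OF assms]] DERIV_y1[OF assms]]]]])
    (simp add: lam2_def algebra_simps power2_eq_square)

lemma C2_on_lam: "C2_on {0<..} (lam l p w x1)"
proof (rule C2_on_realI)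
  show "continuous_on {0<..} lam2"
    unfolding lam2_def[abs_def] using y_interior
    by (intro continuous_intros cont_y cont_y1 cont_y2) force+
qed (use DERIV_lam DERIV_lam1 in \<open>auto intro: has_field_derivative_at_within\<close>)

text \<open>Continuity of \<open>\<eta>\<close> at 0 sends \<open>y\<close> to 0, so its power with
  exponent l + 2 > 0 vanishes while the other factor tends to 1.\<close>

lemma lam_tendsto_0_at_0: "(lam l p w x1 \<longlongrightarrow> 0) (at_right 0)"
proof -
  have "((\<lambda>\<alpha>::real. \<alpha> / (\<alpha> + 1)) \<longlongrightarrow> 0) (at_right 0)"
    by (auto intro!: tendsto_eq_intros)
  then have "(y \<longlongrightarrow> \<eta> 0) (at_right 0)"
    unfolding y_def[abs_def]
    by (rule continuous_on_tendsto_compose[OF cont_eta]) (auto intro!: eventually_at_rightI[of 0 1])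
  then have "((\<lambda>\<alpha>. y \<alpha> powr (l + 2)) \<longlongrightarrow> 0) (at_right 0)"
    unfolding eta_0 using l y_interior
    by (intro tendsto_zero_powrI[where b = "l + 2"]) (force intro!: eventually_at_rightI[of 0 1])+
  moreover have "((\<lambda>\<alpha>::real. (\<alpha> + 1) powr (1 - p)) \<longlongrightarrow> 1) (at_right 0)"
    by (auto intro!: tendsto_eq_intros)
  ultimately show ?thesis
    unfolding lam_eq by (auto intro: tendsto_eq_intros)
qed

text \<open>The factors change roles: \<open>y\<close> tends to \<open>x1\<close>, so its power
  stays bounded, and the factor with exponent 1 - p < 0 tends to 0.\<close>

lemma lam_tendsto_0_at_top: "(lam l p w x1 \<longlongrightarrow> 0) at_top"
proof -
  have "((\<lambda>\<alpha>::real. \<alpha> / (\<alpha> + 1)) \<longlongrightarrow> 1) at_top"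
    by real_asymp
  then have "(y \<longlongrightarrow> \<eta> 1) at_top"
    unfolding y_def[abs_def]
    by (rule continuous_on_tendsto_compose[OF cont_eta]) (auto intro!: eventually_at_top_linorderI[of 1])
  then have "((\<lambda>\<alpha>. y \<alpha> powr (l + 2)) \<longlongrightarrow> x1 powr (l + 2)) at_top"
    unfolding eta_1 using x1 by (auto intro!: tendsto_intros)
  moreover have "((\<lambda>\<alpha>::real. (\<alpha> + 1) powr (1 - p)) \<longlongrightarrow> 0) at_top"
    using p by real_asymp
  ultimately show ?thesis
    unfolding lam_eq by (auto intro: tendsto_eq_intros)
qed

section \<open>Sign of the derivative of the bifurcation parameter\<close>

definition h :: "real \<Rightarrow> real"
  where "h x = (p - 1) * (x * w' x) + (l + 2) * (w x + 1)"

lemma cont_h: "continuous_on {0..x1} h"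
  unfolding h_def[abs_def] by (intro continuous_intros cont_w cont_w')

lemma h_less: "h b < h a" if "0 \<le> a" "a < b" "b \<le> x1"
proof (rule DERIV_neg_imp_decreasing_open[OF \<open>a < b\<close>])
  show "\<exists>D. DERIV h x :> D \<and> D < 0" if "a < x" "x < b" for x
  proof (intro exI conjI)
    have x: "x \<in> {0<..<x1}"
      using that \<open>0 \<le> a\<close> \<open>b \<le> x1\<close> by auto
    show "DERIV h x :> (p - 1) * (w' x + x * w2 x) + (l + 2) * w' x"
      unfolding h_def[abs_def]
      by (auto intro!: derivative_eq_intros DERIV_w_at[OF x] DERIV_w'_at[OF x] simp: algebra_simps)
    have "w' x < 0" "w2 x < 0" "x > 0"
      using w'_neg[of x] w2_neg[of x] x by auto
    then show "(p - 1) * (w' x + x * w2 x) + (l + 2) * w' x < 0"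
      using p l by (intro add_neg_neg mult_pos_neg) auto
  qed
  show "continuous_on {a..b} h"
    using that by (intro continuous_on_subset[OF cont_h]) auto
qed

text \<open>Taking out the common powers leaves (1 - p) * y + (l + 2) * (\<alpha> + 1) * y1. Since w
  y + 1 = 1 / (\<alpha> + 1), multiplying this by the positive number - w' y gives
  \<open>h\<close>.\<close>

lemma lam1_eq: assumes "\<alpha> > 0"
  shows "lam1 \<alpha> = (\<alpha> + 1) powr (- p) * y \<alpha> powr (l + 1) / (- w' (y \<alpha>)) * h (y \<alpha>)"
proof -
  have y: "y \<alpha> > 0" using y_interior[OF assms] by simp
  have 1: "y \<alpha> powr (l + 2) = y \<alpha> powr (l + 1) * y \<alpha>"
    using y powr_add[of "y \<alpha>" "l + 1" 1] by (simp add: add.assoc)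
  have 2: "(\<alpha> + 1) powr (1 - p) = (\<alpha> + 1) powr (- p) * (\<alpha> + 1)"
    using assms powr_add[of "\<alpha> + 1" "- p" 1] by simp
  have 3: "w (y \<alpha>) + 1 = 1 / (\<alpha> + 1)"
    using assms by (simp add: w_y field_simps)
  have "lam1 \<alpha> = (\<alpha> + 1) powr (- p) * y \<alpha> powr (l + 1)
      * ((1 - p) * y \<alpha> + (l + 2) * ((\<alpha> + 1) * y1 \<alpha>))"
    unfolding lam1_def 1 2 by (simp add: algebra_simps)
  also have "(\<alpha> + 1) * y1 \<alpha> = - (w (y \<alpha>) + 1) / w' (y \<alpha>)"
    unfolding y1_def 3 using assms w'_y_neg[OF assms] by (simp add: power2_eq_square)
  also have "(1 - p) * y \<alpha> + (l + 2) * (- (w (y \<alpha>) + 1) / w' (y \<alpha>)) = h (y \<alpha>) / (- w' (y \<alpha>))"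
    unfolding h_def using w'_y_neg[OF assms] by (simp add: field_simps)
  finally show ?thesis by simp
qed

lemma lam1_sign:
  assumes "\<alpha> > 0"
  shows "lam1 \<alpha> > 0 \<longleftrightarrow> h (y \<alpha>) > 0" "lam1 \<alpha> < 0 \<longleftrightarrow> h (y \<alpha>) < 0" "lam1 \<alpha> = 0 \<longleftrightarrow> h (y \<alpha>) = 0"
proof -
  define c where "c = (\<alpha> + 1) powr (- p) * y \<alpha> powr (l + 1) / (- w' (y \<alpha>))"
  have "c > 0"
    unfolding c_def using assms y_interior[OF assms] w'_y_neg[OF assms]
    by (intro divide_pos_pos mult_pos_pos) auto
  then show "lam1 \<alpha> > 0 \<longleftrightarrow> h (y \<alpha>) > 0" "lam1 \<alpha> < 0 \<longleftrightarrow> h (y \<alpha>) < 0" "lam1 \<alpha> = 0 \<longleftrightarrow> h (y \<alpha>) = 0"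
    unfolding lam1_eq[OF assms] c_def[symmetric] by (auto simp: zero_less_mult_iff mult_less_0_iff)
qed

lemma h_y_root: obtains a where "a > 0" "h (y a) = 0"
proof -
  \<comment> \<open>The values are h 0 = l + 2 and h x1 = (p - 1) * x1 * w' x1; the strict sign of
    \<open>w'\<close> at \<open>x1\<close> enters here.\<close>
  have ends: "h 0 > 0" "h x1 < 0"
    using l p x1 w'_neg[of x1] by (auto simp: h_def w_0 w_x1 mult_less_0_iff)
  then obtain x where x: "0 \<le> x" "x \<le> x1" "h x = 0"
    using IVT2'[of h x1 0 0] cont_h x1 by auto
  with ends have x': "0 < x" "x < x1"
    by (metis less_eq_real_def less_irrefl)+
  \<comment> \<open>Solution of a / (a + 1) = - w x, so that \<open>y a\<close> is the zero x of
    \<open>h\<close>.\<close>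
  define a where "a = - w x / (w x + 1)"
  have w: "w x > -1" "w x < 0"
    using w_gt[of x] w_less[of 0 x] x' w_0 by auto
  then have "a / (a + 1) = - w x"
    by (simp add: a_def field_simps)
  then have "y a = x"
    using eta_w[of x] x by (simp add: y_def)
  moreover have "a > 0"
    using w by (simp add: a_def divide_neg_pos)
  ultimately show ?thesis
    using that x(3) by blast
qed

lemma deriv_lam: "\<alpha> > 0 \<Longrightarrow> deriv (lam l p w x1) \<alpha> = lam1 \<alpha>"
  by (rule DERIV_imp_deriv[OF DERIV_lam])

lemma lam_unimodal:
  "\<exists>a>0. (\<forall>\<alpha>. 0 < \<alpha> \<and> \<alpha> < a \<longrightarrow> deriv (lam l p w x1) \<alpha> > 0)
    \<and> deriv (lam l p w x1) a = 0 \<and> (\<forall>\<alpha>>a. deriv (lam l p w x1) \<alpha> < 0)"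
proof -
  obtain a where a: "a > 0" "h (y a) = 0" by (rule h_y_root)
  \<comment> \<open>\<open>h\<close> decreases and \<open>y\<close> increases, so the composition is
    strictly decreasing; comparison with its zero at a gives the sign on either side.\<close>
  have "h (y c) < h (y b)" if "0 < b" "b < c" for b c
    using that y_interior[of b] y_interior[of c] by (intro h_less y_less) auto
  then show ?thesis
    using a by (intro exI[of _ a]) (force simp: deriv_lam lam1_sign)
qed

section \<open>The solution family\<close>

text \<open>The odd extension of \<open>w'\<close>, which is the derivative of the even extension of
  \<open>w\<close>.\<close>

definition W1 :: "real \<Rightarrow> real"
  where "W1 t = sgn t * w' \<bar>t\<bar>"

lemma DERIV_W: "\<bar>t\<bar> < x1 \<Longrightarrow> ((\<lambda>t. w \<bar>t\<bar>) has_real_derivative W1 t) (at t)"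
  unfolding W1_def by (rule DERIV_even_extension[OF DERIV_w w'_0])

lemma DERIV_W1: "\<bar>t\<bar> < x1 \<Longrightarrow> (W1 has_real_derivative w2 \<bar>t\<bar>) (at t)"
  unfolding W1_def[abs_def] by (rule DERIV_odd_extension[OF DERIV_w' w'_0])

text \<open>Since y > 0, y * |x| = |y * x|, so \<open>U\<close> is the even extension of
  \<open>w\<close> composed with the product of y \<alpha> and x. No case distinction at x = 0
  remains, and the partial derivatives follow from the chain rule.\<close>

lemma C2_on_U: "C2_on ({-1..1} \<times> {0<..}) (\<lambda>(x, \<alpha>). U w x1 x \<alpha>)"
proof -
  let ?S = "{-1..1::real} \<times> {0::real<..}"
  let ?Y = "\<lambda>z::real\<times>real. y (snd z)" and ?Y1 = "\<lambda>z::real\<times>real. y1 (snd z)"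
    and ?Y2 = "\<lambda>z::real\<times>real. y2 (snd z)"
  let ?W = "\<lambda>z. w \<bar>?Y z * fst z\<bar>" and ?W1 = "\<lambda>z. W1 (?Y z * fst z)"
    and ?W2 = "\<lambda>z. w2 \<bar>?Y z * fst z\<bar>"
  \<comment> \<open>Even for |x| = 1 the argument stays strictly below \<open>x1\<close>, so the
    two-sided derivatives \<open>DERIV_W\<close> and \<open>DERIV_W1\<close> apply on the whole
    strip.\<close>
  have range: "\<bar>?Y z * fst z\<bar> < x1" if "z \<in> ?S" for z
  proof -
    have "?Y z * \<bar>fst z\<bar> \<le> ?Y z * 1"
      using that y_interior[of "snd z"] by (intro mult_left_mono) auto
    also have "\<dots> < x1"
      using that y_interior[of "snd z"] by auto
    finally show ?thesis
      using that y_interior[of "snd z"] by (force simp: abs_mult)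
  qed
  have fst: "(fst has_derivative fst) (at z within ?S)" and snd: "(snd has_derivative snd) (at z within ?S)" for z
    by (intro bounded_linear_imp_has_derivative bounded_linear_fst bounded_linear_snd)+
  have Y: "(?Y has_derivative (\<lambda>h. snd h * ?Y1 z)) (at z within ?S)"
    and Y1: "(?Y1 has_derivative (\<lambda>h. snd h * ?Y2 z)) (at z within ?S)" if "z \<in> ?S" for z
    using that by (intro DERIV_compose_FDERIV[where g = snd] DERIV_y DERIV_y1 derivative_intros; force)+
  have t: "((\<lambda>z. ?Y z * fst z) has_derivative (\<lambda>h. fst h * ?Y z + snd h * (?Y1 z * fst z))) (at z within ?S)"
    if "z \<in> ?S" for z
    by (rule has_derivative_eq_rhs[OF has_derivative_mult
          [OF Y[OF that] fst]])
      (simp add: algebra_simps)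
  have W: "(?W has_derivative (\<lambda>h. (fst h * ?Y z + snd h * (?Y1 z * fst z)) * ?W1 z)) (at z within ?S)"
    and W1: "(?W1 has_derivative (\<lambda>h. (fst h * ?Y z + snd h * (?Y1 z * fst z)) * ?W2 z)) (at z within ?S)"
    if "z \<in> ?S" for z
    using DERIV_compose_FDERIV[OF DERIV_W[OF range[OF that]] t[OF that]]
      DERIV_compose_FDERIV[OF DERIV_W1[OF range[OF that]] t[OF that]] by auto
  have cont: "continuous_on ?S ?Y" "continuous_on ?S ?Y1" "continuous_on ?S ?Y2" "continuous_on ?S ?W1"
    by (auto intro!: continuous_on_compose2[OF cont_y] continuous_on_compose2[OF cont_y1]
        continuous_on_compose2[OF cont_y2] continuous_intros has_derivative_continuous_on[OF W1])
  have cont_W2: "continuous_on ?S ?W2"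
    using range by (intro continuous_on_compose2[OF cont_w2] continuous_intros cont) (force simp: less_imp_le)+
  show ?thesis
  proof (rule C2_on_prodI)
    fix z assume z: "z \<in> ?S"
    have *: "((\<lambda>z. (snd z + 1) * ?W z + snd z) has_derivative
      (\<lambda>h. fst h * ((snd z + 1) * ?Y z * ?W1 z)
         + snd h * (?W z + (snd z + 1) * ?Y1 z * fst z * ?W1 z + 1))) (at z within ?S)"
      by (rule snd W[OF z] derivative_eq_intros refl)+ (simp add: algebra_simps)
    show "((\<lambda>(x, \<alpha>). U w x1 x \<alpha>) has_derivative
      (\<lambda>h. fst h * ((snd z + 1) * ?Y z * ?W1 z)
         + snd h * (?W z + (snd z + 1) * ?Y1 z * fst z * ?W1 z + 1))) (at z within ?S)"
      \<comment> \<open>Positivity of y moves it inside the absolute value, which identifies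
        \<open>U\<close> with the function in \<open>*\<close>.\<close>
      using y_interior
      by (intro has_derivative_transform[OF z _ *]) (force simp: U_def y_def abs_mult)
    \<comment> \<open>The coefficient of \<open>snd h\<close> found here is the coefficient of
      \<open>fst h\<close> in the next derivative: the mixed partial derivatives agree.\<close>
    show "((\<lambda>z. (snd z + 1) * ?Y z * ?W1 z) has_derivative
      (\<lambda>h. fst h * ((snd z + 1) * (?Y z)\<^sup>2 * ?W2 z)
         + snd h * (?Y z * ?W1 z + (snd z + 1) * ?Y1 z * ?W1 z
             + (snd z + 1) * ?Y z * ?Y1 z * fst z * ?W2 z))) (at z within ?S)"
      by (rule snd W1[OF z] Y[OF z] derivative_eq_intros refl)+ (simp add: algebra_simps power2_eq_square)
    show "((\<lambda>z. ?W z + (snd z + 1) * ?Y1 z * fst z * ?W1 z + 1) has_derivative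
      (\<lambda>h. fst h * (?Y z * ?W1 z + (snd z + 1) * ?Y1 z * ?W1 z
             + (snd z + 1) * ?Y z * ?Y1 z * fst z * ?W2 z)
         + snd h * (2 * ?Y1 z * fst z * ?W1 z + (snd z + 1) * ?Y2 z * fst z * ?W1 z
             + (snd z + 1) * (?Y1 z * fst z)\<^sup>2 * ?W2 z))) (at z within ?S)"
      by (rule fst snd W[OF z] W1[OF z] Y1[OF z] derivative_eq_intros refl)+ (simp add: algebra_simps power2_eq_square)
  qed (intro continuous_intros cont cont_W2)+
qed

end

theorem proposition1p3:
  fixes l p x1 :: real and w w' w'' :: "real \<Rightarrow> real"
  assumes "l > 0" and "p > 1" and "x1 > 0"
    and "solves_ivp l p x1 w w' w''"
    and "\<forall>x\<in>{0<..<x1}. -1 < w x \<and> w x < 0 \<and> w' x < 0 \<and> w'' x < 0"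
    and "w x1 = -1" and "w' x1 < 0"
  shows "C2_on {0<..} (lam l p w x1)
    \<and> C2_on ({-1..1} \<times> {0<..}) (\<lambda>(x, \<alpha>). U w x1 x \<alpha>)
    \<and> (lam l p w x1 \<longlongrightarrow> 0) (at_right 0)
    \<and> (lam l p w x1 \<longlongrightarrow> 0) at_top
    \<and> (\<exists>a>0.
         (\<forall>\<alpha>. 0 < \<alpha> \<and> \<alpha> < a \<longrightarrow> deriv (lam l p w x1) \<alpha> > 0)
         \<and> deriv (lam l p w x1) a = 0
         \<and> (\<forall>\<alpha>>a. deriv (lam l p w x1) \<alpha> < 0))"
proof -
  interpret lane_emden_solution l p x1 w w'
  proof
    fix x assume x: "x \<in> {0<..x1}"
    then have "(w' has_real_derivative w'' x) (at x within {0..x1})"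
      and "w'' x = - (x powr l * (w x + 1) powr p)"
      using assms(4) by (force simp: solves_ivp_def add_eq_0_iff2)+
    then show "(w' has_real_derivative - (x powr l * (w x + 1) powr p)) (at x within {0..x1})"
      by simp
    show "w' x < 0"
      using assms(5,7) x by (cases "x = x1") auto
  qed (use assms in \<open>auto simp: solves_ivp_def\<close>)
  show ?thesis
    using C2_on_lam C2_on_U lam_tendsto_0_at_0 lam_tendsto_0_at_top lam_unimodal by blast
qed

end
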